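(* Let $r>0$ be a value of $|\cdot|_p$ on $\mathbb{Q}_p$. The sphere $S_r(0)$ is invariant for $f$ if and only if $r\in A$.
   Context: $p$ is a prime, $a,b\in\mathbb{Q}_p$ with $ab\neq0$, and $\sqrt{a^2-4b}$ is assumed to exist in $\mathbb{Q}_p$. $f(x)=\frac{x^3+ax^2+bx}{ax+b}$ is considered on $\mathbb{Q}_p\setminus\{-\frac{b}{a}\}$. Let $x_1,x_2=\frac{-a\pm\sqrt{a^2-4b}}{2}\in\mathbb{Q}_p$, labelled so that $\alpha:=|x_1|_p\leq\beta:=|x_2|_p$, and $\delta=|a|_p$. (One has $\delta\leq\alpha$ if $\alpha=\beta$, and $\delta=\beta$ if $\alpha<\beta$.) Define $A=\{r:0<r<\alpha\}$ if $\delta\leq\alpha=\beta$, and $A=(0,\beta)\setminus\{\alpha\}$ if $\alpha<\beta=\delta$. $S_r(0)=\{x\in\mathbb{Q}_p:|x|_p=r\}$. The sphere $S_r(0)$ is invariant for $f$ if $x\in S_r(0)$ implies that $f^n(x)$ is defined and lies in $S_r(0)$ for all $n\geq1$. *)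

theory Defs
  imports Complex_Main "HOL-Computational_Algebra.Primes" "Berlekamp_Zassenhaus.Finite_Field"
begin

section \<open>The \<open>p\<close>-adic absolute value on the rationals\<close>

definition padic_abs :: "nat \<Rightarrow> rat \<Rightarrow> real" where
  "padic_abs p q = (if q = 0 then 0 else
     real p powi (int (multiplicity (int p) (snd (quotient_of q)))
                - int (multiplicity (int p) (fst (quotient_of q)))))"

lemma padic_abs_0 [simp]: "padic_abs p 0 = 0"
  by (simp add: padic_abs_def)

lemma padic_abs_divide:
  assumes p: "prime p" and m: "m \<noteq> 0" and n: "n \<noteq> 0"
  shows "padic_abs p (of_int m / of_int n) =
    real p powi (int (multiplicity (int p) n) - int (multiplicity (int p) m))"
proof -
  obtain c d where cd: "quotient_of (of_int m / of_int n) = (c, d)"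
    by (cases "quotient_of (of_int m / of_int n :: rat)")
  have d: "d > 0" using quotient_of_denom_pos[OF cd] .
  have e: "(of_int m / of_int n :: rat) = of_int c / of_int d"
    using quotient_of_div[OF cd] .
  with m n d have c: "c \<noteq> 0" by auto
  have "(of_int m :: rat) * of_int d = of_int c * of_int n"
    using e n d by (simp add: frac_eq_eq)
  then have eq: "m * d = c * n" by (metis of_int_mult of_int_eq_iff)
  have pe: "prime_elem (int p)" using p by simp
  have "multiplicity (int p) m + multiplicity (int p) d = multiplicity (int p) c + multiplicity (int p) n"
    using arg_cong[OF eq, of "multiplicity (int p)"] m n c d
    by (simp add: prime_elem_multiplicity_mult_distrib[OF pe])
  then have "int (multiplicity (int p) d) - int (multiplicity (int p) c)
           = int (multiplicity (int p) n) - int (multiplicity (int p) m)" by linarith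
  then show ?thesis using m n by (simp add: padic_abs_def cd)
qed

lemma rat_common_denom:
  fixes x y :: rat
  obtains a b d :: int where "d \<noteq> 0" "x = of_int a / of_int d" "y = of_int b / of_int d"
proof -
  obtain a c where x: "x = of_int a / of_int c" "c > 0"
    by (metis quotient_of_div quotient_of_denom_pos surj_pair)
  obtain b e where y: "y = of_int b / of_int e" "e > 0"
    by (metis quotient_of_div quotient_of_denom_pos surj_pair)
  show thesis
    by (rule that[of "c * e" "a * e" "b * c"]) (use x y in auto)
qed

lemma padic_abs_1 [simp]: "prime p \<Longrightarrow> padic_abs p 1 = 1"
  using padic_abs_divide[of p 1 1] by simp

lemma padic_abs_nonneg [simp]: "padic_abs p x \<ge> 0"
  by (simp add: padic_abs_def)

lemma padic_abs_eq_0_iff [simp]: "prime p \<Longrightarrow> padic_abs p x = 0 \<longleftrightarrow> x = 0"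
  by (auto simp: padic_abs_def power_int_eq_0_iff)

lemma padic_abs_mult:
  assumes p: "prime p"
  shows "padic_abs p (x * y) = padic_abs p x * padic_abs p y"
proof (cases "x = 0 \<or> y = 0")
  case False
  obtain a b d :: int where d: "d \<noteq> 0" "x = of_int a / of_int d" "y = of_int b / of_int d"
    by (rule rat_common_denom)
  with False have ab: "a \<noteq> 0" "b \<noteq> 0" by auto
  have pe: "prime_elem (int p)" using p by simp
  have p0: "real p \<noteq> 0" using p by auto
  have "x * y = of_int (a * b) / of_int (d * d)" using d by simp
  then have "padic_abs p (x * y) = real p powi (int (multiplicity (int p) (d * d))
      - int (multiplicity (int p) (a * b)))"
    using padic_abs_divide[OF p, of "a * b" "d * d"] ab d by simp
  also have "\<dots> = real p powi ((int (multiplicity (int p) d) - int (multiplicity (int p) a))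
      + (int (multiplicity (int p) d) - int (multiplicity (int p) b)))"
    by (simp add: prime_elem_multiplicity_mult_distrib[OF pe ab] prime_elem_multiplicity_mult_distrib[OF pe d(1) d(1)] algebra_simps)
  also have "\<dots> = padic_abs p x * padic_abs p y"
    unfolding d(2,3) padic_abs_divide[OF p ab(1) d(1)] padic_abs_divide[OF p ab(2) d(1)]
    by (rule power_int_add) (use p0 in simp)
  finally show ?thesis .
qed auto

lemma padic_abs_minus [simp]:
  assumes "prime p" shows "padic_abs p (- x) = padic_abs p x"
proof -
  have "padic_abs p (-1) = 1"
    using padic_abs_divide[OF assms, of "-1" 1] by (simp add: multiplicity_unit_right)
  then show ?thesis using padic_abs_mult[OF assms, of "-1" x] by simp
qed

lemma padic_abs_ultra:
  assumes p: "prime p"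
  shows "padic_abs p (x + y) \<le> max (padic_abs p x) (padic_abs p y)"
proof (cases "x = 0 \<or> y = 0 \<or> x + y = 0")
  case False
  obtain a b d :: int where d: "d \<noteq> 0" "x = of_int a / of_int d" "y = of_int b / of_int d"
    by (rule rat_common_denom)
  with False have ab: "a \<noteq> 0" "b \<noteq> 0" by auto
  have s: "x + y = of_int (a + b) / of_int d" using d by (simp add: add_divide_distrib)
  with False have ab2: "a + b \<noteq> 0" by auto
  define k where "k = min (multiplicity (int p) a) (multiplicity (int p) b)"
  have "int p ^ k dvd a" "int p ^ k dvd b"
    unfolding k_def by (rule multiplicity_dvd', simp)+
  then have "int p ^ k dvd a + b" by simp
  moreover have pu: "\<not> is_unit (int p)" using p not_prime_unit[of "int p"] by auto
  ultimately have k: "k \<le> multiplicity (int p) (a + b)"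
    using ab2 pu by (meson multiplicity_geI)
  have p1: "real p \<ge> 1" using p prime_ge_1_nat by force
  have "padic_abs p (x + y) \<le> real p powi (int (multiplicity (int p) d) - int k)"
    unfolding s padic_abs_divide[OF p ab2 d(1)] by (rule power_int_increasing) (use k p1 in auto)
  also have "\<dots> \<le> max (padic_abs p x) (padic_abs p y)"
    unfolding d(2,3) padic_abs_divide[OF p ab(1) d(1)] padic_abs_divide[OF p ab(2) d(1)]
    by (cases "multiplicity (int p) a \<le> multiplicity (int p) b") (simp_all add: k_def)
  finally show ?thesis .
qed (auto simp: max_def)

lemma padic_abs_triangle: "prime p \<Longrightarrow> padic_abs p (x + y) \<le> padic_abs p x + padic_abs p y"
  using padic_abs_ultra[of p x y] padic_abs_nonneg[of p x] padic_abs_nonneg[of p y] by linarith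

lemma padic_abs_commute: "prime p \<Longrightarrow> padic_abs p (x - y) = padic_abs p (y - x)"
  using padic_abs_minus[of p "x - y"] by simp

lemma padic_abs_abs_diff:
  assumes "prime p" shows "\<bar>padic_abs p x - padic_abs p y\<bar> \<le> padic_abs p (x - y)"
  using padic_abs_triangle[OF assms, of "x - y" y] padic_abs_triangle[OF assms, of "y - x" x]
    padic_abs_commute[OF assms, of x y] by simp

lemma padic_abs_inverse:
  assumes "prime p" shows "padic_abs p (inverse x) = inverse (padic_abs p x)"
proof (cases "x = 0")
  case False
  then show ?thesis
    using padic_abs_mult[OF assms, of x "inverse x"] assms
    by (simp add: inverse_eq_divide[of "padic_abs p x"] eq_divide_eq mult.commute)
qed simp


section \<open>Cauchy sequences and null sequences\<close>

definition padic_Cauchy :: "nat \<Rightarrow> (nat \<Rightarrow> rat) \<Rightarrow> bool" where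
  "padic_Cauchy p X \<longleftrightarrow> (\<forall>e>0. \<exists>k. \<forall>m\<ge>k. \<forall>n\<ge>k. padic_abs p (X m - X n) < e)"

definition padic_null :: "nat \<Rightarrow> (nat \<Rightarrow> rat) \<Rightarrow> bool" where
  "padic_null p X \<longleftrightarrow> (\<lambda>n. padic_abs p (X n)) \<longlonglongrightarrow> 0"

lemma padic_null_le:
  assumes "Y \<longlonglongrightarrow> 0" "\<And>n. padic_abs p (X n) \<le> Y n"
  shows "padic_null p X"
  unfolding padic_null_def
  by (rule tendsto_sandwich[OF _ _ tendsto_const assms(1)]) (auto simp: assms(2))

lemma padic_null_0 [simp]: "padic_null p (\<lambda>n. 0)"
  by (simp add: padic_null_def)

lemma padic_null_minus [simp]: "prime p \<Longrightarrow> padic_null p (\<lambda>n. - X n) \<longleftrightarrow> padic_null p X"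
  by (simp add: padic_null_def)

lemma padic_null_add:
  assumes "prime p" "padic_null p X" "padic_null p Y" shows "padic_null p (\<lambda>n. X n + Y n)"
  by (rule padic_null_le[of "\<lambda>n. padic_abs p (X n) + padic_abs p (Y n)"])
    (use assms tendsto_add[of _ "0::real" _ _ 0] in \<open>auto simp: padic_null_def padic_abs_triangle\<close>)

lemma padic_null_diff_commute:
  "prime p \<Longrightarrow> padic_null p (\<lambda>n. X n - Y n) \<longleftrightarrow> padic_null p (\<lambda>n. Y n - X n)"
  using padic_null_minus[of p "\<lambda>n. X n - Y n"] by simp

lemma padic_Cauchy_const [simp]: "padic_Cauchy p (\<lambda>n. c)"
  by (simp add: padic_Cauchy_def)

lemma padic_Cauchy_minus: "prime p \<Longrightarrow> padic_Cauchy p X \<Longrightarrow> padic_Cauchy p (\<lambda>n. - X n)"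
  using padic_abs_commute[of p] by (simp add: padic_Cauchy_def)

lemma padic_Cauchy_bound:
  assumes "prime p" "padic_Cauchy p X" "padic_Cauchy p Y" "C > 0"
    and le: "\<And>m n. m \<ge> N \<Longrightarrow> n \<ge> N \<Longrightarrow> padic_abs p (Z m - Z n)
            \<le> C * (padic_abs p (X m - X n) + padic_abs p (Y m - Y n))"
  shows "padic_Cauchy p Z"
  unfolding padic_Cauchy_def
proof (intro allI impI)
  fix e :: real assume "e > 0"
  then have e: "e / (2 * C) > 0" using \<open>C > 0\<close> by simp
  obtain i where i: "\<And>m n. m \<ge> i \<Longrightarrow> n \<ge> i \<Longrightarrow> padic_abs p (X m - X n) < e / (2 * C)"
    using assms(2) e unfolding padic_Cauchy_def by blast
  obtain j where j: "\<And>m n. m \<ge> j \<Longrightarrow> n \<ge> j \<Longrightarrow> padic_abs p (Y m - Y n) < e / (2 * C)"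
    using assms(3) e unfolding padic_Cauchy_def by blast
  show "\<exists>k. \<forall>m\<ge>k. \<forall>n\<ge>k. padic_abs p (Z m - Z n) < e"
  proof (intro exI[of _ "max N (max i j)"] allI impI)
    fix m n assume mn: "max N (max i j) \<le> m" "max N (max i j) \<le> n"
    then have "padic_abs p (X m - X n) + padic_abs p (Y m - Y n) < e / (2 * C) + e / (2 * C)"
      by (intro add_strict_mono i j) auto
    also have "\<dots> = e / C" by simp
    finally have "C * (padic_abs p (X m - X n) + padic_abs p (Y m - Y n)) < e"
      using \<open>C > 0\<close> by (simp add: pos_less_divide_eq mult.commute)
    with le[of m n] mn show "padic_abs p (Z m - Z n) < e" by simp
  qed
qed

lemma padic_Cauchy_add:
  assumes "prime p" "padic_Cauchy p X" "padic_Cauchy p Y" shows "padic_Cauchy p (\<lambda>n. X n + Y n)"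
  by (rule padic_Cauchy_bound[OF assms, of 1])
    (simp_all add: add_diff_add padic_abs_triangle assms(1))

lemma padic_Cauchy_convergent_abs:
  assumes "prime p" "padic_Cauchy p X" shows "convergent (\<lambda>n. padic_abs p (X n))"
proof -
  have "Cauchy (\<lambda>n. padic_abs p (X n))"
    unfolding Cauchy_def dist_real_def
    using assms(2) padic_abs_abs_diff[OF assms(1)] unfolding padic_Cauchy_def
    by (meson le_less_trans)
  then show ?thesis by (simp add: Cauchy_convergent_iff)
qed

lemma padic_Cauchy_bounded:
  assumes "prime p" "padic_Cauchy p X" obtains B where "B > 0" "\<And>n. padic_abs p (X n) \<le> B"
proof -
  have "Bseq (\<lambda>n. padic_abs p (X n))"
    using padic_Cauchy_convergent_abs[OF assms] by (rule convergent_imp_Bseq)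
  then show thesis using that by (auto elim!: BseqE)
qed

lemma padic_abs_mult_diff:
  assumes "prime p"
  shows "padic_abs p (x * y - x' * y')
    \<le> padic_abs p x * padic_abs p (y - y') + padic_abs p y' * padic_abs p (x - x')"
proof -
  have "x * y - x' * y' = x * (y - y') + y' * (x - x')" by (simp add: algebra_simps)
  then show ?thesis
    using padic_abs_triangle[OF assms, of "x * (y - y')" "y' * (x - x')"]
    by (simp add: padic_abs_mult[OF assms])
qed

lemma padic_Cauchy_mult:
  assumes "prime p" "padic_Cauchy p X" "padic_Cauchy p Y" shows "padic_Cauchy p (\<lambda>n. X n * Y n)"
proof -
  obtain B where B: "B > 0" "\<And>n. padic_abs p (X n) \<le> B" using padic_Cauchy_bounded[OF assms(1,2)] by blast
  obtain C where C: "C > 0" "\<And>n. padic_abs p (Y n) \<le> C" using padic_Cauchy_bounded[OF assms(1,3)] by blast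
  show ?thesis
  proof (rule padic_Cauchy_bound[OF assms, of "B + C"])
    fix m n
    have "padic_abs p (X m * Y m - X n * Y n)
        \<le> padic_abs p (X m) * padic_abs p (Y m - Y n) + padic_abs p (Y n) * padic_abs p (X m - X n)"
      by (rule padic_abs_mult_diff[OF assms(1)])
    also have "\<dots> \<le> (B + C) * padic_abs p (Y m - Y n) + (B + C) * padic_abs p (X m - X n)"
      using B C by (intro add_mono mult_right_mono) (auto intro: add_increasing add_increasing2 less_imp_le)
    finally show "padic_abs p (X m * Y m - X n * Y n)
        \<le> (B + C) * (padic_abs p (X m - X n) + padic_abs p (Y m - Y n))"
      by (simp add: algebra_simps)
  qed (use B C in auto)
qed

lemma padic_Cauchy_lower_bound:
  assumes "prime p" "padic_Cauchy p X" "\<not> padic_null p X"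
  obtains b k where "b > 0" "\<And>n. n \<ge> k \<Longrightarrow> padic_abs p (X n) > b"
proof -
  obtain L where L: "(\<lambda>n. padic_abs p (X n)) \<longlonglongrightarrow> L"
    using padic_Cauchy_convergent_abs[OF assms(1,2)] by (auto simp: convergent_def)
  have "L \<ge> 0" by (rule LIMSEQ_le_const[OF L]) auto
  moreover have "L \<noteq> 0" using L assms(3) by (auto simp: padic_null_def)
  ultimately have "L / 2 > 0" "L / 2 < L" by auto
  then show thesis
    using that[of "L / 2"] order_tendstoD(1)[OF L, of "L / 2"] by (auto simp: eventually_sequentially)
qed

lemma padic_abs_inverse_diff_le:
  assumes p: "prime p" and b: "b > 0" and xy: "padic_abs p x > b" "padic_abs p y > b"
  shows "padic_abs p (inverse x - inverse y) \<le> inverse (b * b) * padic_abs p (x - y)"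
proof -
  have nz: "x \<noteq> 0" "y \<noteq> 0" using xy b by auto
  have "padic_abs p (inverse x - inverse y)
      = padic_abs p (x - y) * inverse (padic_abs p x * padic_abs p y)"
    using nz p
    by (simp add: inverse_diff_inverse padic_abs_mult padic_abs_inverse)
  also have "\<dots> \<le> padic_abs p (x - y) * inverse (b * b)"
    using xy b by (intro mult_left_mono le_imp_inverse_le mult_mono) auto
  finally show ?thesis by (simp add: mult.commute)
qed

lemma padic_Cauchy_inverse:
  assumes "prime p" "padic_Cauchy p X" "\<not> padic_null p X"
  shows "padic_Cauchy p (\<lambda>n. inverse (X n))"
proof -
  obtain b k where b: "b > 0" "\<And>n. n \<ge> k \<Longrightarrow> padic_abs p (X n) > b"
    using padic_Cauchy_lower_bound[OF assms] by blast
  show ?thesis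
    by (rule padic_Cauchy_bound[OF assms(1,2) padic_Cauchy_const, of "inverse (b * b)" k _ 0])
      (use b padic_abs_inverse_diff_le[OF assms(1) b(1)] in auto)
qed

lemma padic_null_tendsto:
  assumes p: "prime p" and "padic_null p (\<lambda>n. X n - Y n)"
  shows "(\<lambda>n. padic_abs p (X n) - padic_abs p (Y n)) \<longlonglongrightarrow> 0"
proof (rule tendsto_rabs_zero_cancel, rule tendsto_sandwich[OF _ _ tendsto_const])
  show "(\<lambda>n. padic_abs p (X n - Y n)) \<longlonglongrightarrow> 0" using assms(2) by (simp add: padic_null_def)
qed (use padic_abs_abs_diff[OF p] in auto)

lemma padic_null_cong:
  assumes p: "prime p" and "padic_null p (\<lambda>n. X n - Y n)"
  shows "padic_null p X \<longleftrightarrow> padic_null p Y"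
  using padic_null_add[OF p assms(2), of Y] padic_null_diff_commute[OF p, of X Y] assms(2)
    padic_null_add[OF p, of "\<lambda>n. Y n - X n" X] by auto


section \<open>The field of \<open>p\<close>-adic numbers\<close>

text \<open>
  The prime \<open>p\<close> is \<open>CARD('p)\<close>, and \<open>'p padic\<close> is the completion of the rationals
  with respect to \<^term>\<open>padic_abs CARD('p::prime_card)\<close>: Cauchy sequences modulo null sequences.
\<close>

definition padic_rel :: "nat \<Rightarrow> (nat \<Rightarrow> rat) \<Rightarrow> (nat \<Rightarrow> rat) \<Rightarrow> bool" where
  "padic_rel p X Y \<longleftrightarrow> padic_Cauchy p X \<and> padic_Cauchy p Y \<and> padic_null p (\<lambda>n. X n - Y n)"

lemma padic_rel_refl: "padic_Cauchy p X \<Longrightarrow> padic_rel p X X"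
  by (simp add: padic_rel_def)

lemma part_equivp_padic_rel: "prime p \<Longrightarrow> part_equivp (padic_rel p)"
proof (rule part_equivpI)
  show "\<exists>X. padic_rel p X X" by (rule exI[of _ "\<lambda>n. 0"]) (simp add: padic_rel_def)
  assume p: "prime p"
  show "symp (padic_rel p)"
    by (rule sympI) (auto simp: padic_rel_def intro: padic_null_diff_commute[OF p, THEN iffD1])
  show "transp (padic_rel p)"
  proof (rule transpI)
    fix X Y Z assume "padic_rel p X Y" "padic_rel p Y Z"
    then show "padic_rel p X Z"
      using padic_null_add[OF p, of "\<lambda>n. X n - Y n" "\<lambda>n. Y n - Z n"] by (simp add: padic_rel_def)
  qed
qed

typedef (overloaded) ('a::prime_card) padic =
  "{C. \<exists>X. padic_rel CARD('a) X X \<and> C = Collect (padic_rel CARD('a) X)}"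
  by (auto intro!: exI[of _ "\<lambda>n. 0"] padic_rel_refl)

definition padic_of_seq :: "(nat \<Rightarrow> rat) \<Rightarrow> 'a::prime_card padic" where
  "padic_of_seq X = Abs_padic (Collect (padic_rel CARD('a) X))"

definition seq_of_padic :: "'a::prime_card padic \<Rightarrow> nat \<Rightarrow> rat" where
  "seq_of_padic x = (SOME X. X \<in> Rep_padic x)"

definition cr_padic :: "(nat \<Rightarrow> rat) \<Rightarrow> 'a::prime_card padic \<Rightarrow> bool" where
  "cr_padic = (\<lambda>X x. padic_rel CARD('a) X X \<and> padic_of_seq X = x)"

lemma Quotient_padic:
  "Quotient (padic_rel CARD('a)) padic_of_seq seq_of_padic (cr_padic :: _ \<Rightarrow> 'a::prime_card padic \<Rightarrow> bool)"
proof -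
  interpret quot_type "padic_rel CARD('a)" "Abs_padic :: _ \<Rightarrow> 'a padic" Rep_padic
    by standard (use part_equivp_padic_rel[OF prime_card] Rep_padic
      in \<open>auto simp: Rep_padic_inverse Rep_padic_inject intro!: Abs_padic_inverse\<close>)
  have "abs = padic_of_seq" "rep = seq_of_padic"
    by (simp_all add: fun_eq_iff abs_def rep_def padic_of_seq_def seq_of_padic_def)
  with Quotient have "Quotient3 (padic_rel CARD('a)) (padic_of_seq :: _ \<Rightarrow> 'a padic) seq_of_padic"
    by simp
  then show ?thesis
    by (rule Quotient3_to_Quotient) (simp add: cr_padic_def)
qed

setup_lifting Quotient_padic

instantiation padic :: (prime_card) field
begin

lift_definition zero_padic :: "'a padic" is "\<lambda>n. 0"
  by (simp add: padic_rel_refl)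

lift_definition one_padic :: "'a padic" is "\<lambda>n. 1"
  by (simp add: padic_rel_refl)

lift_definition plus_padic :: "'a padic \<Rightarrow> 'a padic \<Rightarrow> 'a padic" is "\<lambda>X Y n. X n + Y n"
  by (simp add: padic_rel_def add_diff_add padic_Cauchy_add padic_null_add prime_card)

lift_definition uminus_padic :: "'a padic \<Rightarrow> 'a padic" is "\<lambda>X n. - X n"
  by (auto simp: padic_rel_def prime_card intro: padic_Cauchy_minus padic_null_diff_commute[THEN iffD1])

lift_definition times_padic :: "'a padic \<Rightarrow> 'a padic \<Rightarrow> 'a padic" is "\<lambda>X Y n. X n * Y n"
proof -
  fix X X' Y Y' :: "nat \<Rightarrow> rat"
  let ?p = "CARD('a)"
  have p: "prime ?p" by (rule prime_card)
  assume *: "padic_rel ?p X X'" "padic_rel ?p Y Y'"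
  then have C: "padic_Cauchy ?p X" "padic_Cauchy ?p Y'" by (simp_all add: padic_rel_def)
  obtain B where B: "B > 0" "\<And>n. padic_abs ?p (X n) \<le> B" using padic_Cauchy_bounded[OF p C(1)] by blast
  obtain D where D: "D > 0" "\<And>n. padic_abs ?p (Y' n) \<le> D" using padic_Cauchy_bounded[OF p C(2)] by blast
  have "padic_null ?p (\<lambda>n. X n * Y n - X' n * Y' n)"
  proof (rule padic_null_le)
    show "(\<lambda>n. B * padic_abs ?p (Y n - Y' n) + D * padic_abs ?p (X n - X' n)) \<longlonglongrightarrow> 0"
      using * by (intro tendsto_add_zero tendsto_mult_right_zero)
        (simp_all add: padic_rel_def padic_null_def)
    fix n
    show "padic_abs ?p (X n * Y n - X' n * Y' n)
        \<le> B * padic_abs ?p (Y n - Y' n) + D * padic_abs ?p (X n - X' n)"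
      by (rule order_trans[OF padic_abs_mult_diff[OF p]])
        (intro add_mono mult_right_mono B D padic_abs_nonneg)
  qed
  with * show "padic_rel ?p (\<lambda>n. X n * Y n) (\<lambda>n. X' n * Y' n)"
    by (simp add: padic_rel_def padic_Cauchy_mult[OF p])
qed

lift_definition inverse_padic :: "'a padic \<Rightarrow> 'a padic"
  is "\<lambda>X. if padic_null CARD('a) X then (\<lambda>n. 0) else (\<lambda>n. inverse (X n))"
proof -
  fix X Y :: "nat \<Rightarrow> rat"
  let ?p = "CARD('a)"
  have p: "prime ?p" by (rule prime_card)
  assume *: "padic_rel ?p X Y"
  then have C: "padic_Cauchy ?p X" "padic_Cauchy ?p Y" and XY: "padic_null ?p (\<lambda>n. X n - Y n)"
    by (simp_all add: padic_rel_def)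
  have iff: "padic_null ?p X \<longleftrightarrow> padic_null ?p Y" by (rule padic_null_cong[OF p XY])
  have "padic_null ?p (\<lambda>n. inverse (X n) - inverse (Y n))" if nX: "\<not> padic_null ?p X"
  proof -
    obtain b k where b: "b > 0" "\<And>n. n \<ge> k \<Longrightarrow> padic_abs ?p (X n) > b"
      using padic_Cauchy_lower_bound[OF p C(1) nX] by blast
    obtain c l where c: "c > 0" "\<And>n. n \<ge> l \<Longrightarrow> padic_abs ?p (Y n) > c"
      using padic_Cauchy_lower_bound[OF p C(2)] nX iff by blast
    have bd: "padic_abs ?p (inverse (X n) - inverse (Y n))
        \<le> inverse (min b c * min b c) * padic_abs ?p (X n - Y n)" if "n \<ge> max k l" for n
      using b(1) c(1) b(2)[of n] c(2)[of n] that
      by (intro padic_abs_inverse_diff_le[OF p]) auto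
    have ev: "eventually (\<lambda>n. padic_abs ?p (inverse (X n) - inverse (Y n))
        \<le> inverse (min b c * min b c) * padic_abs ?p (X n - Y n)) sequentially"
      by (rule eventually_sequentiallyI, rule bd)
    have z: "(\<lambda>n. inverse (min b c * min b c) * padic_abs ?p (X n - Y n)) \<longlonglongrightarrow> 0"
      using XY unfolding padic_null_def by (rule tendsto_mult_right_zero)
    show ?thesis
      unfolding padic_null_def
      by (rule tendsto_sandwich[OF _ ev tendsto_const z]) simp
  qed
  with iff C show "padic_rel ?p
      (if padic_null ?p X then (\<lambda>n. 0) else (\<lambda>n. inverse (X n)))
      (if padic_null ?p Y then (\<lambda>n. 0) else (\<lambda>n. inverse (Y n)))"
    by (simp add: padic_rel_def padic_Cauchy_inverse[OF p])
qed

definition "x - y = x + - y" for x y :: "'a padic"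

definition "x div y = x * inverse y" for x y :: "'a padic"

instance
proof
  fix a b c :: "'a padic"
  have p: "prime CARD('a)" by (rule prime_card)
  note rel = padic_rel_def padic_Cauchy_add[OF p] padic_Cauchy_mult[OF p] padic_Cauchy_minus[OF p]
  show "a + b = b + a"
    by transfer (simp add: rel add.commute)
  show "(a + b) + c = a + (b + c)"
    by transfer (simp add: rel add.assoc)
  show "0 + a = a"
    by transfer (simp add: rel)
  show "- a + a = 0"
    by transfer (simp add: rel)
  show "a - b = a + - b"
    by (rule minus_padic_def)
  show "(a * b) * c = a * (b * c)"
    by transfer (simp add: rel mult.assoc)
  show "a * b = b * a"
    by transfer (simp add: rel mult.commute)
  show "1 * a = a"
    by transfer (simp add: rel)
  show "(a + b) * c = a * c + b * c"
    by transfer (simp add: rel distrib_right)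
  have "\<not> (\<lambda>n. 1::real) \<longlonglongrightarrow> 0"
    using LIMSEQ_unique tendsto_const zero_neq_one by blast
  then show "(0::'a padic) \<noteq> 1"
    by transfer (simp add: rel padic_null_def p)
  have "padic_null CARD('a) (\<lambda>n. inverse (X n) * X n - 1)"
    if X: "padic_Cauchy CARD('a) X" "\<not> padic_null CARD('a) X" for X
  proof -
    obtain b k where b: "b > 0" "\<And>n. n \<ge> k \<Longrightarrow> padic_abs CARD('a) (X n) > b"
      using padic_Cauchy_lower_bound[OF p X] by blast
    have "padic_abs CARD('a) (inverse (X n) * X n - 1) = 0" if "n \<ge> k" for n
      using b(1) b(2)[OF that] by (cases "X n = 0") auto
    then show ?thesis
      unfolding padic_null_def by (intro tendsto_eventually) (auto simp: eventually_sequentially)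
  qed
  then show "a \<noteq> 0 \<Longrightarrow> inverse a * a = 1"
    by transfer (auto simp: rel padic_Cauchy_inverse[OF p])
  show "a div b = a * inverse b"
    by (rule divide_padic_def)
  show "inverse (0::'a padic) = 0"
    by transfer (simp add: rel)
qed

end

lift_definition padic_norm :: "'p::prime_card padic \<Rightarrow> real" ("\<bar>_\<bar>\<^sub>p")
  is "\<lambda>X. lim (\<lambda>n. padic_abs CARD('p) (X n))"
proof -
  fix X Y :: "nat \<Rightarrow> rat"
  have p: "prime CARD('p)" by (rule prime_card)
  assume *: "padic_rel CARD('p) X Y"
  obtain L where L: "(\<lambda>n. padic_abs CARD('p) (X n)) \<longlonglongrightarrow> L"
    using * padic_Cauchy_convergent_abs[OF p] by (auto simp: convergent_def padic_rel_def)
  have "(\<lambda>n. padic_abs CARD('p) (X n) - padic_abs CARD('p) (Y n)) \<longlonglongrightarrow> 0"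
    using * padic_null_tendsto[OF p] by (simp add: padic_rel_def)
  from tendsto_diff[OF L this] L
  show "lim (\<lambda>n. padic_abs CARD('p) (X n)) = lim (\<lambda>n. padic_abs CARD('p) (Y n))"
    by (simp add: limI)
qed


section \<open>The dynamical system\<close>

definition padic_sphere :: "real \<Rightarrow> 'p::prime_card padic set" where
  "padic_sphere r = {x. \<bar>x\<bar>\<^sub>p = r}"

text \<open>\<open>f\<close> is a partial map: \<open>None\<close> is the value at the excluded point \<open>-b/a\<close>.\<close>

definition f_map :: "'p::prime_card padic \<Rightarrow> 'p padic \<Rightarrow> 'p padic \<Rightarrow> 'p padic option" where
  "f_map a b x = (if x = - (b / a) then None
     else Some ((x ^ 3 + a * x\<^sup>2 + b * x) / (a * x + b)))"

primrec iter_partial :: "nat \<Rightarrow> ('a \<Rightarrow> 'a option) \<Rightarrow> 'a \<Rightarrow> 'a option" where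
  "iter_partial 0 f x = Some x"
| "iter_partial (Suc n) f x = Option.bind (iter_partial n f x) f"

definition invariant_under :: "('a \<Rightarrow> 'a option) \<Rightarrow> 'a set \<Rightarrow> bool" where
  "invariant_under f S \<longleftrightarrow> (\<forall>x\<in>S. \<forall>n\<ge>1. \<exists>y\<in>S. iter_partial n f x = Some y)"

text \<open>
  The last branch is empty only to make the function total: for \<open>\<alpha> \<le> \<beta>\<close> the absolute values of the
  two roots of \<open>x\<^sup>2 + a x + b\<close> and \<open>\<delta>\<close> that of \<open>a\<close>, one of the first two cases holds.
\<close>

definition radius_set :: "real \<Rightarrow> real \<Rightarrow> real \<Rightarrow> real set" where
  "radius_set \<alpha> \<beta> \<delta> =
    (if \<delta> \<le> \<alpha> \<and> \<alpha> = \<beta> then {0<..<\<alpha>}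
     else if \<alpha> < \<beta> \<and> \<beta> = \<delta> then {0<..<\<beta>} - {\<alpha>}
     else {})"

end

theory Submission
  imports Defs
begin

text \<open>
  Writing \<open>f(x) = x (x\<^sup>2 + (a x + b)) / (a x + b)\<close>, the ultrametric inequality shows that \<open>f\<close>
  preserves \<open>\<bar>x\<bar>\<close> where \<open>\<bar>x\<^sup>2\<bar> < \<bar>a x + b\<bar>\<close> and increases it where \<open>\<bar>x\<^sup>2\<bar> > \<bar>a x + b\<bar>\<close>. By Vieta,
  \<open>\<bar>b\<bar> = \<alpha> \<beta>\<close> and \<open>\<bar>a\<bar> = \<bar>x1 + x2\<bar>\<close>, so for \<open>\<bar>x\<bar> \<noteq> \<alpha>, \<beta>\<close> the first case is \<open>\<bar>x\<bar> < \<beta>\<close> and the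
  second is \<open>\<bar>x\<bar> > \<beta>\<close>. The spheres of radius \<open>\<alpha>\<close> and \<open>\<beta>\<close> contain a root of \<open>x\<^sup>2 + a x + b\<close>, which
  \<open>f\<close> sends to \<open>0\<close>.
\<close>

section \<open>The \<open>p\<close>-adic norm\<close>

text \<open>\<open>lim\<close> is meaningful only for convergent sequences. Cauchy representatives
  supply convergence, so properties of \<open>padic_abs\<close> pass to the norm as limits.\<close>

lemma padic_norm_LIMSEQ:
  assumes "padic_Cauchy CARD('p::prime_card) X"
  shows "(\<lambda>n. padic_abs CARD('p) (X n)) \<longlonglongrightarrow> lim (\<lambda>n. padic_abs CARD('p) (X n))"
  using padic_Cauchy_convergent_abs[OF prime_card assms] by (simp add: convergent_LIMSEQ_iff)

lemma padic_norm_nonneg: "\<bar>x\<bar>\<^sub>p \<ge> 0" for x :: "'p::prime_card padic"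
proof transfer
  fix X assume "padic_rel CARD('p) X X"
  then have "padic_Cauchy CARD('p) X"
    by (simp add: padic_rel_def)
  from padic_norm_LIMSEQ[OF this] show "lim (\<lambda>n. padic_abs CARD('p) (X n)) \<ge> 0"
    by (rule LIMSEQ_le_const) simp
qed

lemma padic_norm_eq_0_iff: "\<bar>x\<bar>\<^sub>p = 0 \<longleftrightarrow> x = 0" for x :: "'p::prime_card padic"
proof transfer
  fix X assume "padic_rel CARD('p) X X"
  then have X: "padic_Cauchy CARD('p) X"
    by (simp add: padic_rel_def)
  have "lim (\<lambda>n. padic_abs CARD('p) (X n)) = 0 \<longleftrightarrow> padic_null CARD('p) X"
    unfolding padic_null_def using padic_norm_LIMSEQ[OF X] by (metis limI)
  then show "lim (\<lambda>n. padic_abs CARD('p) (X n)) = 0 \<longleftrightarrow> padic_rel CARD('p) X (\<lambda>n. 0)"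
    using X by (simp add: padic_rel_def)
qed

lemma padic_norm_mult: "\<bar>x * y\<bar>\<^sub>p = \<bar>x\<bar>\<^sub>p * \<bar>y\<bar>\<^sub>p" for x y :: "'p::prime_card padic"
proof transfer
  fix X Y assume "padic_rel CARD('p) X X" "padic_rel CARD('p) Y Y"
  then have "padic_Cauchy CARD('p) X" "padic_Cauchy CARD('p) Y"
    by (simp_all add: padic_rel_def)
  from tendsto_mult[OF this[THEN padic_norm_LIMSEQ]]
  show "lim (\<lambda>n. padic_abs CARD('p) (X n * Y n)) =
      lim (\<lambda>n. padic_abs CARD('p) (X n)) * lim (\<lambda>n. padic_abs CARD('p) (Y n))"
    by (simp add: padic_abs_mult[OF prime_card] limI)
qed

lemma padic_norm_minus: "\<bar>- x\<bar>\<^sub>p = \<bar>x\<bar>\<^sub>p" for x :: "'p::prime_card padic"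
  by transfer (simp add: prime_card)

lemma padic_norm_add_le_max: "\<bar>x + y\<bar>\<^sub>p \<le> max \<bar>x\<bar>\<^sub>p \<bar>y\<bar>\<^sub>p" for x y :: "'p::prime_card padic"
proof transfer
  fix X Y assume "padic_rel CARD('p) X X" "padic_rel CARD('p) Y Y"
  then have X: "padic_Cauchy CARD('p) X" and Y: "padic_Cauchy CARD('p) Y"
    by (simp_all add: padic_rel_def)
  show "lim (\<lambda>n. padic_abs CARD('p) (X n + Y n))
      \<le> max (lim (\<lambda>n. padic_abs CARD('p) (X n))) (lim (\<lambda>n. padic_abs CARD('p) (Y n)))"
    using padic_norm_LIMSEQ[OF padic_Cauchy_add[OF prime_card X Y]]
      tendsto_max[OF padic_norm_LIMSEQ[OF X] padic_norm_LIMSEQ[OF Y]]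
    by (rule LIMSEQ_le) (use padic_abs_ultra[OF prime_card] in auto)
qed

text \<open>Isosceles triangle principle: in \<open>x = (x + y) + - y\<close> the summand
  \<open>- y\<close> is too small to account for the norm of \<open>x\<close>.\<close>

lemma padic_norm_add_eq_left:
  fixes x y :: "'p::prime_card padic"
  assumes "\<bar>y\<bar>\<^sub>p < \<bar>x\<bar>\<^sub>p"
  shows "\<bar>x + y\<bar>\<^sub>p = \<bar>x\<bar>\<^sub>p"
proof -
  have "\<bar>(x + y) + - y\<bar>\<^sub>p \<le> max \<bar>x + y\<bar>\<^sub>p \<bar>y\<bar>\<^sub>p"
    using padic_norm_add_le_max[of "x + y" "- y"] by (simp only: padic_norm_minus)
  then have "\<bar>x\<bar>\<^sub>p \<le> max \<bar>x + y\<bar>\<^sub>p \<bar>y\<bar>\<^sub>p"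
    by (simp only: add.assoc add.right_inverse add_0_right)
  with padic_norm_add_le_max[of x y] assms show ?thesis
    by linarith
qed

lemma padic_norm_add_eq_right:
  fixes x y :: "'p::prime_card padic"
  assumes "\<bar>x\<bar>\<^sub>p < \<bar>y\<bar>\<^sub>p"
  shows "\<bar>x + y\<bar>\<^sub>p = \<bar>y\<bar>\<^sub>p"
  using padic_norm_add_eq_left[OF assms] by (simp only: add.commute)

lemma padic_norm_0: "\<bar>0 :: 'p::prime_card padic\<bar>\<^sub>p = 0"
  by (simp add: padic_norm_eq_0_iff)

text \<open>Makes the halves in the root formula legitimate even when the prime is 2: the constant
  sequence has a constant nonzero absolute value, so it is not null.\<close>

lemma padic_two_neq_0: "(2 :: 'p::prime_card padic) \<noteq> 0"
proof -
  have "\<not> padic_rel CARD('p) (\<lambda>n. 1 + 1) (\<lambda>n. 0)"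
    by (simp add: padic_rel_def padic_null_def prime_card LIMSEQ_const_iff)
  then have "(1 + 1 :: 'p padic) \<noteq> 0"
    by transfer
  then show ?thesis
    by simp
qed


section \<open>Invariant spheres\<close>

lemma invariant_under_iff:
  "invariant_under f S \<longleftrightarrow> (\<forall>x\<in>S. \<exists>y\<in>S. f x = Some y)"
proof
  assume inv: "invariant_under f S"
  show "\<forall>x\<in>S. \<exists>y\<in>S. f x = Some y"
  proof
    fix x assume "x \<in> S"
    with inv have "\<exists>y\<in>S. iter_partial 1 f x = Some y"
      unfolding invariant_under_def by blast
    then show "\<exists>y\<in>S. f x = Some y"
      by simp
  qed
next
  assume step: "\<forall>x\<in>S. \<exists>y\<in>S. f x = Some y"
  \<comment> \<open>The induction starts at \<open>n = 0\<close>, where the iterate is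
    \<open>x\<close> itself.\<close>
  have "\<exists>y\<in>S. iter_partial n f x = Some y" if "x \<in> S" for n x
    using that by (induction n) (use step in auto)
  then show "invariant_under f S"
    by (simp add: invariant_under_def)
qed

text \<open>This form isolates the two terms \<open>x * x\<close> and \<open>a * x + b\<close> whose
  norms decide the dynamics; their sum is the quadratic with roots \<open>x1\<close> and
  \<open>x2\<close>.\<close>

lemma f_map_eq:
  fixes a b x :: "'p::prime_card padic"
  assumes "a \<noteq> 0"
  shows "f_map a b x =
    (if a * x + b = 0 then None else Some (x * (x * x + (a * x + b)) / (a * x + b)))"
proof -
  have "x = - (b / a) \<longleftrightarrow> a * x + b = 0"
  proof -
    have "a * x + b = a * (x - - (b / a))"
      using assms by (simp add: distrib_left)
    then show ?thesis
      using assms by (simp only: mult_eq_0_iff right_minus_eq simp_thms)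
  qed
  moreover have "x ^ 3 + a * x\<^sup>2 + b * x = x * (x * x + (a * x + b))"
    by (simp add: power2_eq_square power3_eq_cube algebra_simps)
  ultimately show ?thesis
    by (simp only: f_map_def)
qed

text \<open>The denominator dominates the factor \<open>x * x + (a * x + b)\<close>, so the two have
  equal norms and cancel.\<close>

lemma f_map_preserves_norm:
  fixes a b x :: "'p::prime_card padic"
  assumes "a \<noteq> 0" and less: "\<bar>x * x\<bar>\<^sub>p < \<bar>a * x + b\<bar>\<^sub>p"
  shows "\<exists>y. f_map a b x = Some y \<and> \<bar>y\<bar>\<^sub>p = \<bar>x\<bar>\<^sub>p"
proof -
  define d where "d = a * x + b"
  define y where "y = x * (x * x + d) / d"
  have d: "\<bar>d\<bar>\<^sub>p > 0"
    using less padic_norm_nonneg[of "x * x"] by (simp add: d_def)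
  then have d0: "d \<noteq> 0"
    using padic_norm_eq_0_iff[of d] by auto
  then have "y * d = x * (x * x + d)"
    by (simp add: y_def)
  then have "\<bar>y\<bar>\<^sub>p * \<bar>d\<bar>\<^sub>p = \<bar>x\<bar>\<^sub>p * \<bar>x * x + d\<bar>\<^sub>p"
    by (metis padic_norm_mult)
  also have "\<bar>x * x + d\<bar>\<^sub>p = \<bar>d\<bar>\<^sub>p"
    using padic_norm_add_eq_right[of "x * x" d] less by (simp add: d_def)
  finally have "\<bar>y\<bar>\<^sub>p = \<bar>x\<bar>\<^sub>p"
    using d by simp
  then show ?thesis
    using d0 f_map_eq[OF assms(1), of b x] by (simp add: d_def y_def)
qed

text \<open>Now \<open>x * x\<close> dominates the factor, whose norm therefore exceeds that of the
  denominator.\<close>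

lemma f_map_increases_norm:
  fixes a b x y :: "'p::prime_card padic"
  assumes "a \<noteq> 0" and less: "\<bar>a * x + b\<bar>\<^sub>p < \<bar>x * x\<bar>\<^sub>p" and y: "f_map a b x = Some y"
  shows "\<bar>x\<bar>\<^sub>p < \<bar>y\<bar>\<^sub>p"
proof -
  define d where "d = a * x + b"
  have d0: "d \<noteq> 0" and "y = x * (x * x + d) / d"
    using y by (auto simp: f_map_eq[OF assms(1)] d_def split: if_splits)
  then have "y * d = x * (x * x + d)"
    by simp
  then have "\<bar>y\<bar>\<^sub>p * \<bar>d\<bar>\<^sub>p = \<bar>x\<bar>\<^sub>p * \<bar>x * x + d\<bar>\<^sub>p"
    by (metis padic_norm_mult)
  also have "\<bar>x * x + d\<bar>\<^sub>p = \<bar>x * x\<bar>\<^sub>p"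
    using padic_norm_add_eq_left[of d "x * x"] less by (simp add: d_def)
  finally have eq: "\<bar>y\<bar>\<^sub>p * \<bar>d\<bar>\<^sub>p = \<bar>x\<bar>\<^sub>p * \<bar>x * x\<bar>\<^sub>p" .
  have d: "\<bar>d\<bar>\<^sub>p > 0"
    using d0 padic_norm_nonneg[of d] padic_norm_eq_0_iff[of d] by linarith
  \<comment> \<open>The strict inequality in \<open>less\<close> excludes
    \<open>x = 0\<close>.\<close>
  have "\<bar>x\<bar>\<^sub>p > 0"
    using less padic_norm_nonneg[of "a * x + b"] padic_norm_nonneg[of x]
    by (auto simp: padic_norm_mult[of x x] less_le)
  with less have "\<bar>x\<bar>\<^sub>p * \<bar>d\<bar>\<^sub>p < \<bar>y\<bar>\<^sub>p * \<bar>d\<bar>\<^sub>p"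
    unfolding eq unfolding d_def by (rule mult_strict_left_mono)
  with d show ?thesis
    by simp
qed

theorem corollary1:
  fixes a b s x1 x2 :: "'p::prime_card padic" and \<alpha> \<beta> \<delta> r :: real
  assumes "a * b \<noteq> 0"
    and "s\<^sup>2 = a\<^sup>2 - 4 * b"
    and "{x1, x2} = {(- a + s) / 2, (- a - s) / 2}"
    and "\<alpha> = \<bar>x1\<bar>\<^sub>p" and "\<beta> = \<bar>x2\<bar>\<^sub>p" and "\<alpha> \<le> \<beta>"
    and "\<delta> = \<bar>a\<bar>\<^sub>p"
    and "r > 0" and "r \<in> range (padic_norm :: 'p padic \<Rightarrow> real)"
  shows "invariant_under (f_map a b) (padic_sphere r) \<longleftrightarrow> r \<in> radius_set \<alpha> \<beta> \<delta>"
proof -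

  \<comment> \<open>Vieta's formulas and the norms of the coefficients\<close>
  have two: "(2 :: 'p padic) \<noteq> 0"
    by (rule padic_two_neq_0)
  have four: "(4 :: 'p padic) \<noteq> 0"
  proof -
    have "(4 :: 'p padic) = 2 * 2"
      by simp
    with two show ?thesis
      by (metis mult_eq_0_iff)
  qed
  have a0: "a \<noteq> 0" and b0: "b \<noteq> 0"
    using assms(1) by auto
  have halve: "2 * (z / 2) = z" for z :: "'p padic"
    using two by simp
  \<comment> \<open>The set equality leaves open which root carries which sign of \<open>s\<close>;
    sum and product are symmetric, so both labellings serve.\<close>
  have roots: "2 * x1 = - a + s \<and> 2 * x2 = - a - s \<or> 2 * x1 = - a - s \<and> 2 * x2 = - a + s"
    using assms(3) by (metis doubleton_eq_iff halve)
  have "2 * (x1 + x2) = 2 * x1 + 2 * x2"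
    by (rule distrib_left)
  also have "\<dots> = 2 * (- a)"
    using roots by (elim disjE conjE) simp_all
  finally have sum: "x1 + x2 = - a"
    using two by (metis mult_left_cancel)
  have "4 * (x1 * x2) = (2 * x1) * (2 * x2)"
    by simp
  also have "\<dots> = (- a + s) * (- a - s)"
    using roots by (metis mult.commute)
  also have "\<dots> = a\<^sup>2 - s\<^sup>2"
    by (simp add: power2_eq_square algebra_simps)
  also have "\<dots> = 4 * b"
    using assms(2) by simp
  finally have prod: "x1 * x2 = b"
    using four by (metis mult_left_cancel)
  have norm_b: "\<bar>b\<bar>\<^sub>p = \<alpha> * \<beta>"
    using prod padic_norm_mult[of x1 x2] assms(4,5) by simp
  have \<delta>: "\<delta> = \<bar>x1 + x2\<bar>\<^sub>p"
    using assms(7) sum padic_norm_minus[of a] by simp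
  have \<delta>_le: "\<delta> \<le> \<beta>"
    using padic_norm_add_le_max[of x1 x2] assms(4,5,6) \<delta> by simp
  have \<delta>_eq: "\<delta> = \<beta>" if "\<alpha> < \<beta>"
    using padic_norm_add_eq_right[of x1 x2] assms(4,5) \<delta> that by simp
  have "\<alpha> * \<beta> \<noteq> 0"
    using norm_b b0 padic_norm_eq_0_iff[of b] by simp
  then have \<alpha>: "\<alpha> > 0" and \<beta>: "\<beta> > 0"
    using padic_norm_nonneg[of x1] padic_norm_nonneg[of x2] assms(4,5) by auto
  \<comment> \<open>If \<alpha> = \<beta>, removing \<alpha> from the open interval changes nothing,
    so one formula covers both cases.\<close>
  have radius_set: "radius_set \<alpha> \<beta> \<delta> = {0<..<\<beta>} - {\<alpha>}"
  proof (cases "\<alpha> < \<beta>")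
    case True
    then show ?thesis
      using \<delta>_eq[OF True] unfolding radius_set_def by simp
  next
    case False
    then have "\<alpha> = \<beta>"
      using assms(6) by linarith
    then show ?thesis
      using \<delta>_le unfolding radius_set_def by (simp only: simp_thms if_True) auto
  qed
  \<comment> \<open>At a root the denominator equals \<open>- (z * z)\<close>, which is nonzero
    because \<open>b\<close> is.\<close>
  have root: "f_map a b z = Some 0" if "z = x1 \<or> z = x2" for z
  proof -
    have a_eq: "a = - (x1 + x2)"
      using sum by simp
    have "z * z + (a * z + b) = (z - x1) * (z - x2)"
      unfolding a_eq prod[symmetric] by (simp add: algebra_simps)
    also have "\<dots> = 0"
      using that by auto
    finally have z: "z * z + (a * z + b) = 0" .
    have "z \<noteq> 0"
      using that prod b0 by auto
    with z have "a * z + b \<noteq> 0"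
      by auto
    with z show ?thesis
      by (simp add: f_map_eq[OF a0])
  qed

  \<comment> \<open>Comparison of \<open>x * x\<close> with \<open>a * x + b\<close> on the
    sphere\<close>
  have norm_ax: "\<bar>a * x\<bar>\<^sub>p = \<delta> * r" if "\<bar>x\<bar>\<^sub>p = r" for x
    using padic_norm_mult[of a x] assms(7) that by simp
  have norm_xx: "\<bar>x * x\<bar>\<^sub>p = r * r" if "\<bar>x\<bar>\<^sub>p = r" for x :: "'p padic"
    using padic_norm_mult[of x x] that by simp
  have small: "\<bar>x * x\<bar>\<^sub>p < \<bar>a * x + b\<bar>\<^sub>p" if x: "\<bar>x\<bar>\<^sub>p = r" and r: "r < \<beta>" "r \<noteq> \<alpha>" for x
  proof (cases "r < \<alpha>")
    \<comment> \<open>Below \<alpha> the constant term \<open>b\<close> dominates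
      \<open>a * x + b\<close>.\<close>
    case True
    have "\<delta> * r \<le> \<beta> * r"
      using \<delta>_le \<open>r > 0\<close> by (intro mult_right_mono) simp_all
    also have "\<dots> < \<alpha> * \<beta>"
      using mult_strict_right_mono[OF True \<beta>] by (simp only: mult.commute)
    finally have "\<bar>a * x + b\<bar>\<^sub>p = \<alpha> * \<beta>"
      using padic_norm_add_eq_right[of "a * x" b] norm_ax[OF x] norm_b by simp
    moreover have "r * r < \<alpha> * \<beta>"
      using True r \<open>r > 0\<close> by (intro mult_strict_mono) auto
    ultimately show ?thesis
      using norm_xx[OF x] by simp
  next
    \<comment> \<open>Between \<alpha> and \<beta> the linear term dominates, since here \<delta> =
      \<beta>.\<close>
    case False
    with r have "\<alpha> < r"
      by simp
    with r have "\<delta> = \<beta>"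
      by (intro \<delta>_eq) simp
    with \<open>\<alpha> < r\<close> have "\<alpha> * \<beta> < \<delta> * r"
      using \<beta> by (simp add: mult.commute)
    then have "\<bar>a * x + b\<bar>\<^sub>p = \<beta> * r"
      using padic_norm_add_eq_left[of b "a * x"] norm_ax[OF x] norm_b \<open>\<delta> = \<beta>\<close> by simp
    then show ?thesis
      using norm_xx[OF x] r \<open>r > 0\<close> by simp
  qed
  \<comment> \<open>Beyond \<beta> an upper bound is enough: both terms of \<open>a * x + b\<close>
    have norm below \<open>r * r\<close>, whichever is larger.\<close>
  have large: "\<bar>a * x + b\<bar>\<^sub>p < \<bar>x * x\<bar>\<^sub>p" if x: "\<bar>x\<bar>\<^sub>p = r" and r: "\<beta> < r" for x
  proof -
    have "\<delta> * r < r * r"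
      using \<delta>_le r \<open>r > 0\<close> by simp
    moreover have "\<alpha> * \<beta> < r * r"
      using assms(6) \<alpha> \<beta> r by (intro mult_strict_mono) auto
    ultimately show ?thesis
      using padic_norm_add_le_max[of "a * x" b] norm_ax[OF x] norm_xx[OF x] norm_b by simp
  qed
  show ?thesis
  proof
    assume inv: "invariant_under (f_map a b) (padic_sphere r)"
    have step: "\<exists>y. f_map a b x = Some y \<and> \<bar>y\<bar>\<^sub>p = r" if "\<bar>x\<bar>\<^sub>p = r" for x
      using inv that by (auto simp: invariant_under_iff padic_sphere_def)
    have no_root: "\<bar>z\<bar>\<^sub>p \<noteq> r" if "z = x1 \<or> z = x2" for z
    proof
      assume "\<bar>z\<bar>\<^sub>p = r"
      from step[OF this] root[OF that] have "\<bar>0 :: 'p padic\<bar>\<^sub>p = r"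
        by simp
      with \<open>r > 0\<close> show False
        by (simp add: padic_norm_0)
    qed
    have "r \<noteq> \<alpha>" "r \<noteq> \<beta>"
      using no_root[of x1] no_root[of x2] unfolding assms(4,5) by auto
    moreover have "\<not> \<beta> < r"
    proof
      assume "\<beta> < r"
      \<comment> \<open>An empty sphere would be vacuously invariant; as \<open>r\<close> is a value
        of the norm, there is a point to escape.\<close>
      obtain x :: "'p padic" where x: "\<bar>x\<bar>\<^sub>p = r"
        using assms(9) by auto
      from step[OF x] obtain y where "f_map a b x = Some y" "\<bar>y\<bar>\<^sub>p = r"
        by blast
      with f_map_increases_norm[OF a0 large[OF x \<open>\<beta> < r\<close>]] x show False
        by auto
    qed
    ultimately show "r \<in> radius_set \<alpha> \<beta> \<delta>"
      using \<open>r > 0\<close> by (simp add: radius_set)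
  next
    assume "r \<in> radius_set \<alpha> \<beta> \<delta>"
    then have r: "r < \<beta>" "r \<noteq> \<alpha>"
      by (simp_all add: radius_set)
    have "\<exists>y\<in>padic_sphere r. f_map a b x = Some y" if "x \<in> padic_sphere r" for x
    proof -
      from that have x: "\<bar>x\<bar>\<^sub>p = r"
        by (simp add: padic_sphere_def)
      from f_map_preserves_norm[OF a0 small[OF x r]] obtain y
        where "f_map a b x = Some y" "\<bar>y\<bar>\<^sub>p = r"
        unfolding x by blast
      then show ?thesis
        by (simp add: padic_sphere_def)
    qed
    then show "invariant_under (f_map a b) (padic_sphere r)"
      by (simp add: invariant_under_iff)
  qed
qed

end
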